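(* Let $S$ be a monoid equipped with a size map $\lambda \colon S \rightarrow \mathbb{N}$. Then the following are equivalent: (1) $S$ is a generalized $1$-monoid with respect to $\lambda$. (2) $S$ is equidivisible, and for every $a \in S$, $a$ is an atom if and only if $\lambda(a) = 1$.
   Context: Here $\mathbb{N}=\{0,1,2,\ldots\}$ under addition. A monoid homomorphism $\lambda \colon S \rightarrow \mathbb{N}$ is a size map if $\lambda^{-1}(0)$ is precisely the group of units of $S$. The monoid $S$ is a generalized $1$-monoid with respect to the size map $\lambda$ if $\lambda$ satisfies the weak factorization property (WFP): whenever $x \in S$ and $m,n \in \mathbb{N}$ satisfy $\lambda(x) = m+n$, there exist elements $x_1, x_2 \in S$ such that $x = x_1x_2$, $\lambda(x_1) = m$ and $\lambda(x_2)=n$, and, furthermore, if $x_1', x_2' \in S$ are any elements such that $x = x_1'x_2'$, $\lambda(x_1')=m$ and $\lambda(x_2')=n$, then $x_1' = x_1g$ and $x_2' = g^{-1}x_2$ for some invertible element $g \in S$. A monoid $S$ is equidivisible if $xy = uv$ in $S$ implies that there exists $t \in S$ such that either $u = xt$ and $y = tv$, or $x = ut$ and $v = ty$. An atom in a monoid is a non-invertible element $a$ such that if $a = bc$ then at least one of $b$ or $c$ is invertible. *)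

theory Defs
  imports "HOL-Algebra.Group"
begin

definition nat_add_monoid :: "nat monoid" where
  "nat_add_monoid = \<lparr>carrier = UNIV, mult = (+), one = 0\<rparr>"

text \<open>Membership in \<^const>\<open>hom\<close> only expresses compatibility with multiplication,
  so preservation of the identity is stated separately.\<close>

definition monoid_hom :: "('a, 'c) monoid_scheme \<Rightarrow> ('b, 'd) monoid_scheme \<Rightarrow> ('a \<Rightarrow> 'b) \<Rightarrow> bool" where
  "monoid_hom S T h \<longleftrightarrow> h \<in> hom S T \<and> h \<one>\<^bsub>S\<^esub> = \<one>\<^bsub>T\<^esub>"

definition size_map :: "('a, 'c) monoid_scheme \<Rightarrow> ('a \<Rightarrow> nat) \<Rightarrow> bool" where
  "size_map S l \<longleftrightarrow>
     monoid_hom S nat_add_monoid l \<and> {x \<in> carrier S. l x = 0} = Units S"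

definition weak_factorization_property :: "('a, 'c) monoid_scheme \<Rightarrow> ('a \<Rightarrow> nat) \<Rightarrow> bool" where
  "weak_factorization_property S l \<longleftrightarrow>
     (\<forall>x \<in> carrier S. \<forall>m n. l x = m + n \<longrightarrow>
        (\<exists>x1 \<in> carrier S. \<exists>x2 \<in> carrier S.
           x = x1 \<otimes>\<^bsub>S\<^esub> x2 \<and> l x1 = m \<and> l x2 = n \<and>
           (\<forall>x1' \<in> carrier S. \<forall>x2' \<in> carrier S.
              x = x1' \<otimes>\<^bsub>S\<^esub> x2' \<and> l x1' = m \<and> l x2' = n \<longrightarrow>
              (\<exists>g \<in> Units S. x1' = x1 \<otimes>\<^bsub>S\<^esub> g \<and> x2' = inv\<^bsub>S\<^esub> g \<otimes>\<^bsub>S\<^esub> x2))))"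

definition generalized_1_monoid :: "('a, 'c) monoid_scheme \<Rightarrow> ('a \<Rightarrow> nat) \<Rightarrow> bool" where
  "generalized_1_monoid S l \<longleftrightarrow>
     monoid S \<and> size_map S l \<and> weak_factorization_property S l"

definition equidivisible :: "('a, 'c) monoid_scheme \<Rightarrow> bool" where
  "equidivisible S \<longleftrightarrow>
     (\<forall>x \<in> carrier S. \<forall>y \<in> carrier S. \<forall>u \<in> carrier S. \<forall>v \<in> carrier S.
        x \<otimes>\<^bsub>S\<^esub> y = u \<otimes>\<^bsub>S\<^esub> v \<longrightarrow>
        (\<exists>t \<in> carrier S.
           (u = x \<otimes>\<^bsub>S\<^esub> t \<and> y = t \<otimes>\<^bsub>S\<^esub> v) \<or>
           (x = u \<otimes>\<^bsub>S\<^esub> t \<and> v = t \<otimes>\<^bsub>S\<^esub> y)))"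

text \<open>This is not the predicate \<open>irreducible\<close> of HOL-Algebra, which is phrased via
  left divisibility and is meant for commutative monoids.\<close>

definition atom :: "('a, 'c) monoid_scheme \<Rightarrow> 'a \<Rightarrow> bool" where
  "atom S a \<longleftrightarrow>
     a \<in> carrier S \<and> a \<notin> Units S \<and>
     (\<forall>b \<in> carrier S. \<forall>c \<in> carrier S.
        a = b \<otimes>\<^bsub>S\<^esub> c \<longrightarrow> b \<in> Units S \<or> c \<in> Units S)"

end

(* If xy = uv with l x \<le> l u, split y as y1 y2 with l y2 = l v: then (x y1) y2 and u v are
   factorizations of the same type, so uniqueness up to a unit yields the equidivisibility witness.
   Conversely, splitting off atoms of size 1 one at a time gives factorizations of every type, and
   the element t that equidivisibility provides for two factorizations of the same type has size 0,
   hence is a unit. *)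
theory Submission
  imports Defs
begin

locale sized_monoid = monoid S for S :: "('a, 'c) monoid_scheme" (structure) +
  fixes l :: "'a \<Rightarrow> nat"
  assumes size_map: "size_map S l"
begin

lemma size_mult: "x \<in> carrier S \<Longrightarrow> y \<in> carrier S \<Longrightarrow> l (x \<otimes> y) = l x + l y"
  using size_map by (auto simp: size_map_def monoid_hom_def hom_def nat_add_monoid_def)

lemma size_one: "l \<one> = 0"
  using size_map by (auto simp: size_map_def monoid_hom_def nat_add_monoid_def)

lemma size_eq_0_iff: "x \<in> carrier S \<Longrightarrow> l x = 0 \<longleftrightarrow> x \<in> Units S"
  using size_map by (auto simp: size_map_def)

lemma Units_r_inv_cancel: "g \<in> Units S \<Longrightarrow> b \<in> carrier S \<Longrightarrow> g \<otimes> (inv g \<otimes> b) = b"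
  by (simp add: Units_closed flip: m_assoc)

text \<open>The factorization property compares every factorization only with one reference pair
  \<open>a\<close>, \<open>b\<close>. Two arbitrary factorizations of the same type are therefore
  compared through that pair. The conclusion has the shape of an equidivisibility witness.\<close>

lemma wfp_unique_up_to_unit:
  assumes wfp: "weak_factorization_property S l"
    and carr: "x \<in> carrier S" "y \<in> carrier S" "u \<in> carrier S" "v \<in> carrier S"
    and eq: "x \<otimes> y = u \<otimes> v" and size: "l x = l u" "l y = l v"
  shows "\<exists>g \<in> Units S. u = x \<otimes> g \<and> y = g \<otimes> v"
proof -
  have "x \<otimes> y \<in> carrier S" "l (x \<otimes> y) = l x + l y"
    using carr by (auto simp: size_mult)
  then obtain a b where ab: "a \<in> carrier S" "b \<in> carrier S"
    and uniq: "\<And>a' b'. \<lbrakk>a' \<in> carrier S; b' \<in> carrier S; x \<otimes> y = a' \<otimes> b'; l a' = l x; l b' = l y\<rbrakk>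
                 \<Longrightarrow> \<exists>g \<in> Units S. a' = a \<otimes> g \<and> b' = inv g \<otimes> b"
    using wfp[unfolded weak_factorization_property_def, rule_format, of "x \<otimes> y" "l x" "l y"]
    by blast
  obtain g where g: "g \<in> Units S" "x = a \<otimes> g" "y = inv g \<otimes> b"
    using uniq[of x y] carr by auto
  obtain h where h: "h \<in> Units S" "u = a \<otimes> h" "v = inv h \<otimes> b"
    using uniq[of u v] carr eq size by auto
  \<comment> \<open>From \<open>x = a \<otimes> g\<close> comes
    \<open>a = x \<otimes> inv g\<close>; substituting this into \<open>u = a \<otimes> h\<close>
    gives the connecting unit.\<close>
  have "u = x \<otimes> (inv g \<otimes> h)"
    using ab g h by (simp add: m_assoc Units_closed Units_r_inv_cancel)
  moreover have "y = (inv g \<otimes> h) \<otimes> v"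
    using ab g h by (simp add: m_assoc Units_closed Units_r_inv_cancel)
  moreover have "inv g \<otimes> h \<in> Units S"
    using g(1) h(1) by (simp add: Units_m_closed)
  ultimately show ?thesis
    by blast
qed

lemma wfp_common_refinement:
  assumes wfp: "weak_factorization_property S l"
    and carr: "x \<in> carrier S" "y \<in> carrier S" "u \<in> carrier S" "v \<in> carrier S"
    and eq: "x \<otimes> y = u \<otimes> v" and le: "l x \<le> l u"
  shows "\<exists>t \<in> carrier S. u = x \<otimes> t \<and> y = t \<otimes> v"
proof -
  have "l x + l y = l u + l v"
    using carr eq by (metis size_mult)
  \<comment> \<open>By \<open>le\<close> the subtraction in the naturals is not truncated, so this
    is a type in which \<open>y\<close> can be split.\<close>
  then have "l y = (l u - l x) + l v"
    using le by simp
  then obtain y1 y2 where y: "y1 \<in> carrier S" "y2 \<in> carrier S" "y = y1 \<otimes> y2"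
    "l y1 = l u - l x" "l y2 = l v"
    using wfp carr unfolding weak_factorization_property_def by meson
  have "(x \<otimes> y1) \<otimes> y2 = u \<otimes> v" "l (x \<otimes> y1) = l u"
    using y carr eq le by (simp_all add: m_assoc size_mult)
  then obtain g where g: "g \<in> Units S" "u = (x \<otimes> y1) \<otimes> g" "y2 = g \<otimes> v"
    using wfp_unique_up_to_unit[OF wfp, of "x \<otimes> y1" y2 u v] y carr by auto
  have "u = x \<otimes> (y1 \<otimes> g)" "y = (y1 \<otimes> g) \<otimes> v"
    using g(2,3) y carr Units_closed[OF g(1)] by (simp_all add: m_assoc)
  moreover have "y1 \<otimes> g \<in> carrier S"
    using y(1) Units_closed[OF g(1)] by simp
  ultimately show ?thesis
    by blast
qed

lemma wfp_imp_equidivisible: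
  assumes "weak_factorization_property S l"
  shows "equidivisible S"
  unfolding equidivisible_def
proof (intro ballI impI)
  fix x y u v
  assume "x \<in> carrier S" "y \<in> carrier S" "u \<in> carrier S" "v \<in> carrier S" "x \<otimes> y = u \<otimes> v"
  then show "\<exists>t \<in> carrier S. (u = x \<otimes> t \<and> y = t \<otimes> v) \<or> (x = u \<otimes> t \<and> v = t \<otimes> y)"
    \<comment> \<open>Sizes are totally ordered; exchanging the two factorizations gives the second
      alternative when \<open>l u \<le> l x\<close>.\<close>
    using wfp_common_refinement[OF assms, of x y u v] wfp_common_refinement[OF assms, of u v x y]
    by (metis nat_le_linear)
qed

text \<open>Two natural numbers with sum 1 include a 0, and elements of size 0 are units. This holds
  for every size map, so the condition on atoms only says that atoms have size 1.\<close>

lemma size_1_imp_atom: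
  assumes a: "a \<in> carrier S" "l a = 1"
  shows "atom S a"
  unfolding atom_def
proof (intro conjI ballI impI)
  show "a \<notin> Units S"
    using a size_eq_0_iff[of a] by simp
next
  fix b c
  assume "b \<in> carrier S" "c \<in> carrier S" "a = b \<otimes> c"
  then show "b \<in> Units S \<or> c \<in> Units S"
    using a(2) size_mult[of b c] size_eq_0_iff[of b] size_eq_0_iff[of c] by auto
qed (fact a)

text \<open>An atom of size at least 2 would split into factors of sizes 1 and
  \<open>l a - 1\<close>, both nonzero, hence into two non-units.\<close>

lemma wfp_atom_imp_size_1:
  assumes wfp: "weak_factorization_property S l" and a: "atom S a"
  shows "l a = 1"
proof (rule ccontr)
  assume "l a \<noteq> 1"
  moreover have carr: "a \<in> carrier S" and "l a \<noteq> 0"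
    using a size_eq_0_iff by (auto simp: atom_def)
  ultimately have "l a = 1 + (l a - 1)" "l a - 1 \<noteq> 0"
    by auto
  then obtain b c where "b \<in> carrier S" "c \<in> carrier S" "a = b \<otimes> c" "l b \<noteq> 0" "l c \<noteq> 0"
    using wfp carr unfolding weak_factorization_property_def by (metis one_neq_zero)
  then show False
    using a size_eq_0_iff by (auto simp: atom_def)
qed

text \<open>Strong induction on size: a non-unit that is not an atom is a product of two non-units,
  and the left one is strictly smaller, so its own left factor of size 1 serves.\<close>

lemma left_factor_of_size_1:
  assumes atoms: "\<And>a. atom S a \<Longrightarrow> l a = 1"
    and "x \<in> carrier S" "l x \<noteq> 0"
  shows "\<exists>a \<in> carrier S. \<exists>y \<in> carrier S. x = a \<otimes> y \<and> l a = 1"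
  using assms(2,3)
proof (induction "l x" arbitrary: x rule: less_induct)
  case less
  show ?case
  proof (cases "atom S x")
    case True
    then show ?thesis
      using atoms less.prems by (metis one_closed r_one)
  next
    case False
    then obtain b c where bc: "b \<in> carrier S" "c \<in> carrier S" "x = b \<otimes> c" "l b \<noteq> 0" "l c \<noteq> 0"
      using less.prems size_eq_0_iff unfolding atom_def by metis
    then have "l b < l x"
      by (simp add: size_mult)
    then obtain a y where "a \<in> carrier S" "y \<in> carrier S" "b = a \<otimes> y" "l a = 1"
      using less.hyps bc by meson
    then show ?thesis
      using bc by (metis m_assoc m_closed)
  qed
qed

text \<open>Induction on \<open>m\<close>: a left factor of size 1 is peeled off, the rest is split
  in type \<open>m\<close>, \<open>n\<close>, and the peeled factor is absorbed on the left. For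
  \<open>m = 0\<close> the splitting is \<open>\<one> \<otimes> x\<close>.\<close>

lemma factorization_of_type:
  assumes atoms: "\<And>a. atom S a \<Longrightarrow> l a = 1"
    and "x \<in> carrier S" "l x = m + n"
  shows "\<exists>y \<in> carrier S. \<exists>z \<in> carrier S. x = y \<otimes> z \<and> l y = m \<and> l z = n"
  using assms(2,3)
proof (induction m arbitrary: x)
  case 0
  then show ?case
    by (metis add_0 l_one one_closed size_one)
next
  case (Suc m)
  then obtain a w where aw: "a \<in> carrier S" "w \<in> carrier S" "x = a \<otimes> w" "l a = 1"
    using left_factor_of_size_1[OF atoms, of x] by auto
  then have "l w = m + n"
    using Suc.prems by (simp add: size_mult)
  then obtain y z where yz: "y \<in> carrier S" "z \<in> carrier S" "w = y \<otimes> z" "l y = m" "l z = n"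
    using Suc.IH aw by meson
  have "x = (a \<otimes> y) \<otimes> z" "l (a \<otimes> y) = Suc m"
    using aw yz by (simp_all add: m_assoc size_mult)
  then show ?case
    using aw yz by (metis m_closed)
qed

lemma equidivisible_unique_up_to_unit:
  assumes equi: "equidivisible S"
    and carr: "x \<in> carrier S" "y \<in> carrier S" "u \<in> carrier S" "v \<in> carrier S"
    and eq: "x \<otimes> y = u \<otimes> v" and size: "l x = l u"
  shows "\<exists>g \<in> Units S. u = x \<otimes> g \<and> v = inv g \<otimes> y"
proof -
  obtain t where t: "t \<in> carrier S"
    "(u = x \<otimes> t \<and> y = t \<otimes> v) \<or> (x = u \<otimes> t \<and> v = t \<otimes> y)"
    using equi[unfolded equidivisible_def, rule_format, OF carr eq] by blast
  \<comment> \<open>Either alternative writes one of \<open>x\<close>, \<open>u\<close> as the other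
    times \<open>t\<close>; their sizes agree and cancel.\<close>
  then have "l t = 0"
    using size carr by (auto simp: size_mult)
  then have unit: "t \<in> Units S"
    using t size_eq_0_iff by blast
  from t(2) show ?thesis
  proof
    assume "u = x \<otimes> t \<and> y = t \<otimes> v"
    then show ?thesis
      using unit t(1) carr by (intro bexI[of _ t]) (auto simp flip: m_assoc)
  next
    assume "x = u \<otimes> t \<and> v = t \<otimes> y"
    \<comment> \<open>Here \<open>t\<close> leads from \<open>u\<close> to \<open>x\<close>, so the
      unit from \<open>x\<close> to \<open>u\<close> is its inverse.\<close>
    then show ?thesis
      using unit t(1) carr by (intro bexI[of _ "inv t"]) (auto simp: m_assoc)
  qed
qed

lemma equidivisible_imp_wfp:
  assumes equi: "equidivisible S" and atoms: "\<And>a. atom S a \<Longrightarrow> l a = 1"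
  shows "weak_factorization_property S l"
  unfolding weak_factorization_property_def
proof (intro ballI allI impI)
  fix x m n
  assume "x \<in> carrier S" "l x = m + n"
  then obtain y z where yz: "y \<in> carrier S" "z \<in> carrier S" "x = y \<otimes> z" "l y = m" "l z = n"
    using factorization_of_type[OF atoms] by meson
  show "\<exists>x1 \<in> carrier S. \<exists>x2 \<in> carrier S. x = x1 \<otimes> x2 \<and> l x1 = m \<and> l x2 = n \<and>
          (\<forall>x1' \<in> carrier S. \<forall>x2' \<in> carrier S. x = x1' \<otimes> x2' \<and> l x1' = m \<and> l x2' = n \<longrightarrow>
             (\<exists>g \<in> Units S. x1' = x1 \<otimes> g \<and> x2' = inv g \<otimes> x2))"
    \<comment> \<open>Any factorization of the required type can serve as the reference
      pair.\<close>
    using yz equidivisible_unique_up_to_unit[OF equi yz(1,2)]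
    by (intro bexI[of _ y] bexI[of _ z]) auto
qed

end

theorem proposition5p1:
  fixes S :: "('a, 'c) monoid_scheme" and l :: "'a \<Rightarrow> nat"
  assumes "monoid S" and "size_map S l"
  shows "generalized_1_monoid S l \<longleftrightarrow>
           equidivisible S \<and> (\<forall>a \<in> carrier S. atom S a \<longleftrightarrow> l a = 1)"
proof -
  interpret sized_monoid S l
    using assms by (simp add: sized_monoid_def sized_monoid_axioms_def)
  \<comment> \<open>This reconciles the condition over the carrier in the theorem with the lemmas,
    which quantify over all atoms.\<close>
  have "a \<in> carrier S" if "atom S a" for a
    using that by (simp add: atom_def)
  then have "weak_factorization_property S l \<longleftrightarrow>
      equidivisible S \<and> (\<forall>a \<in> carrier S. atom S a \<longleftrightarrow> l a = 1)"
    using wfp_imp_equidivisible size_1_imp_atom wfp_atom_imp_size_1 equidivisible_imp_wfp by blast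
  then show ?thesis
    using assms by (simp add: generalized_1_monoid_def)
qed

end
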